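(* Consider the channel creation game with $N>3$ nodes $1,\dots,N$, blockchain fee $F_B>0$, constant forwarding fee $f_0\ge 0$, and the homogeneous payment scenario with $k\ge 1$ payments from every node to every other node. Consider the path strategy combination: for $1\le i\le N-1$ node $i$ opens exactly one channel, to node $i+1$, and node $N$ opens no channel. If $f_0=0$, this strategy combination is a weak Nash equilibrium. If $f_0>0$, it is not a Nash equilibrium.
   Context: Channel creation game. The players are the $N$ nodes. Fixed parameters: a blockchain fee $F_B\in\mathbb{R}$, $F_B>0$, a forwarding fee $f_0\ge 0$ that is the same for all nodes, and a payment scenario (a finite multiset of transactions, each with a sender and a different receiver). In the homogeneous payment scenario, for every ordered pair $(s,r)$ of distinct nodes there are exactly $k$ transactions from $s$ to $r$. Strategies: simultaneously and with full information, each node $u$ chooses a set $\mu_u$ of other nodes to which it opens channels; it pays $F_B$ for each channel it opens. Channels are usable in both directions by everyone and have unlimited capital. The strategy combination determines an undirected graph with an edge $\{u,v\}$ whenever $u$ opens a channel to $v$ or $v$ to $u$. Transactions: a route of a transaction is a path in this graph from sender to receiver; a route with $\ell$ edges costs the sender $(\ell-1)f_0$, and each of its $\ell-1$ intermediate nodes receives $f_0$. If the cheapest route costs less than $F_B$, the transaction is executed along a cheapest (shortest) route; if there are several, one is chosen uniformly at random and costs and revenues are taken in expectation. Otherwise (no route of cost less than $F_B$) the transaction is executed on-chain and the sender pays $F_B$. The cost of node $u$ is $|\mu_u|F_B$, plus the fees $u$ pays as sender (off-chain routing fees, and $F_B$ per on-chain transaction), minus the (expected) forwarding revenue of $u$.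 Each node wants to minimize its cost. A (pure) Nash equilibrium is a strategy combination in which no node can strictly decrease its cost by unilaterally changing its strategy; it is called weak to indicate that deviations with equal cost may exist.
   Formalization: The second claim (not a Nash equilibrium if f_0>0) is proved except when k=1 and f_0≥F_B; in that case the claim is false, since only direct channels are used off-chain, each new channel saves at most one on-chain fee F_B, and the path is a weak Nash equilibrium. *)

theory Defs
  imports "HOL-Probability.Probability_Mass_Function"
begin

type_synonym strategy_combination = "nat \<Rightarrow> nat set"
type_synonym transaction = "nat \<times> nat"  \<comment> \<open>(sender, receiver)\<close>

definition nodes :: "nat \<Rightarrow> nat set" where
  "nodes N = {1..N}"

definition strategies :: "nat \<Rightarrow> nat \<Rightarrow> nat set set" where
  "strategies N u = Pow (nodes N - {u})"

definition channels :: "nat \<Rightarrow> strategy_combination \<Rightarrow> nat set set" where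
  "channels N \<mu> = {{u, v} | u v. u \<in> nodes N \<and> v \<in> \<mu> u}"

text \<open>Routes are paths without repeated nodes, given as the list of visited nodes.\<close>

definition routes :: "nat \<Rightarrow> strategy_combination \<Rightarrow> nat \<Rightarrow> nat \<Rightarrow> nat list set" where
  "routes N \<mu> s r =
     {p. p \<noteq> [] \<and> hd p = s \<and> last p = r \<and> distinct p \<and> set p \<subseteq> nodes N \<and>
         successively (\<lambda>u v. {u, v} \<in> channels N \<mu>) p}"

definition route_edges :: "nat list \<Rightarrow> nat" where
  "route_edges p = length p - 1"

definition route_fee :: "real \<Rightarrow> nat list \<Rightarrow> real" where
  "route_fee f0 p = (real (route_edges p) - 1) * f0"

definition intermediaries :: "nat list \<Rightarrow> nat set" where
  "intermediaries p = set (butlast (tl p))"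

text \<open>For \<open>f0 > 0\<close> the shortest routes are exactly the cheapest ones; for \<open>f0 = 0\<close> all routes
  are equally cheap and still only shortest ones are used.\<close>

definition shortest_routes :: "nat \<Rightarrow> strategy_combination \<Rightarrow> nat \<Rightarrow> nat \<Rightarrow> nat list set" where
  "shortest_routes N \<mu> s r =
     {p \<in> routes N \<mu> s r. \<forall>q \<in> routes N \<mu> s r. route_edges p \<le> route_edges q}"

definition off_chain ::
  "nat \<Rightarrow> real \<Rightarrow> real \<Rightarrow> strategy_combination \<Rightarrow> nat \<Rightarrow> nat \<Rightarrow> bool" where
  "off_chain N F_B f0 \<mu> s r \<longleftrightarrow> (\<exists>p \<in> shortest_routes N \<mu> s r. route_fee f0 p < F_B)"

definition sender_fee ::
  "nat \<Rightarrow> real \<Rightarrow> real \<Rightarrow> strategy_combination \<Rightarrow> transaction \<Rightarrow> real" where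
  "sender_fee N F_B f0 \<mu> t = (case t of (s, r) \<Rightarrow>
     if off_chain N F_B f0 \<mu> s r
     then measure_pmf.expectation (pmf_of_set (shortest_routes N \<mu> s r)) (route_fee f0)
     else F_B)"

definition forwarding_revenue ::
  "nat \<Rightarrow> real \<Rightarrow> real \<Rightarrow> strategy_combination \<Rightarrow> nat \<Rightarrow> transaction \<Rightarrow> real" where
  "forwarding_revenue N F_B f0 \<mu> u t = (case t of (s, r) \<Rightarrow>
     if off_chain N F_B f0 \<mu> s r
     then measure_pmf.expectation (pmf_of_set (shortest_routes N \<mu> s r))
            (\<lambda>p. if u \<in> intermediaries p then f0 else 0)
     else 0)"

definition cost ::
  "nat \<Rightarrow> real \<Rightarrow> real \<Rightarrow> transaction multiset \<Rightarrow> strategy_combination \<Rightarrow> nat \<Rightarrow> real" where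
  "cost N F_B f0 T \<mu> u =
     real (card (\<mu> u)) * F_B
     + (\<Sum>t\<in>#filter_mset (\<lambda>t. fst t = u) T. sender_fee N F_B f0 \<mu> t)
     - (\<Sum>t\<in>#T. forwarding_revenue N F_B f0 \<mu> u t)"

text \<open>The inequality is not strict, so this is the notion of a weak equilibrium: deviations of
  equal cost are allowed.\<close>

definition nash_equilibrium ::
  "nat \<Rightarrow> real \<Rightarrow> real \<Rightarrow> transaction multiset \<Rightarrow> strategy_combination \<Rightarrow> bool" where
  "nash_equilibrium N F_B f0 T \<mu> \<longleftrightarrow>
     (\<forall>u \<in> nodes N. \<mu> u \<in> strategies N u) \<and>
     (\<forall>u \<in> nodes N. \<forall>S \<in> strategies N u.
        cost N F_B f0 T \<mu> u \<le> cost N F_B f0 T (\<mu>(u := S)) u)"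

definition homogeneous_scenario :: "nat \<Rightarrow> nat \<Rightarrow> transaction multiset" where
  "homogeneous_scenario N k =
     repeat_mset k (mset_set {(s, r). s \<in> nodes N \<and> r \<in> nodes N \<and> s \<noteq> r})"

definition path_strategy :: "nat \<Rightarrow> strategy_combination" where
  "path_strategy N i = (if 1 \<le> i \<and> i < N then {i + 1} else {})"

text \<open>If \<open>f0 \<ge> F_B\<close>, only direct channels are ever used off-chain. With a single payment per
  ordered pair, opening a channel then costs exactly as much as the one on-chain payment it
  replaces, and the path is an equilibrium although \<open>f0 > 0\<close>.\<close>

lemma channels_sym_iff:
  assumes "s \<in> nodes N" "r \<in> nodes N"
  shows "{s, r} \<in> channels N \<mu> \<longleftrightarrow> r \<in> \<mu> s \<or> s \<in> \<mu> r"
  using assms by (auto simp: channels_def doubleton_eq_iff)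

lemma routes_length_ge_2:
  assumes "p \<in> routes N \<mu> s r" "s \<noteq> r"
  shows "length p \<ge> 2"
  using assms by (cases p; cases "tl p") (auto simp: routes_def)

lemma routes_length_2:
  assumes "p \<in> routes N \<mu> s r" "length p = 2"
  shows "p = [s, r] \<and> {s, r} \<in> channels N \<mu>"
  using assms by (auto simp: routes_def length_Suc_conv numeral_2_eq_2)

lemma direct_route:
  assumes "s \<in> nodes N" "r \<in> nodes N" "s \<noteq> r" "{s, r} \<in> channels N \<mu>"
  shows "shortest_routes N \<mu> s r = {[s, r]}"
proof -
  have m: "[s, r] \<in> routes N \<mu> s r"
    using assms by (auto simp: routes_def)
  have "p = [s, r]" if "p \<in> shortest_routes N \<mu> s r" for p
  proof -
    from that have p: "p \<in> routes N \<mu> s r" and le: "route_edges p \<le> route_edges [s, r]"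
      using m by (auto simp: shortest_routes_def)
    with routes_length_ge_2[OF p assms(3)] have "length p = 2"
      by (auto simp: route_edges_def)
    with routes_length_2[OF p] show ?thesis by simp
  qed
  moreover have "[s, r] \<in> shortest_routes N \<mu> s r"
    using m routes_length_ge_2[OF _ assms(3)]
    by (fastforce simp: shortest_routes_def route_edges_def)
  ultimately show ?thesis by blast
qed

lemma off_chain_high_fee_iff:
  assumes "0 < F_B" "F_B \<le> f0" "s \<in> nodes N" "r \<in> nodes N" "s \<noteq> r"
  shows "off_chain N F_B f0 \<mu> s r \<longleftrightarrow> {s, r} \<in> channels N \<mu>"
proof
  assume "off_chain N F_B f0 \<mu> s r"
  then obtain p where p: "p \<in> routes N \<mu> s r" and fee: "route_fee f0 p < F_B"
    by (auto simp: off_chain_def shortest_routes_def)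
  have "length p < 3"
  proof (rule ccontr)
    assume "\<not> length p < 3"
    hence "1 * f0 \<le> (real (route_edges p) - 1) * f0"
      using assms by (intro mult_right_mono) (auto simp: route_edges_def)
    with fee assms show False by (simp add: route_fee_def)
  qed
  with routes_length_ge_2[OF p assms(5)] have "length p = 2" by simp
  with routes_length_2[OF p] show "{s, r} \<in> channels N \<mu>" by simp
next
  assume "{s, r} \<in> channels N \<mu>"
  with direct_route[of s N r \<mu>] assms show "off_chain N F_B f0 \<mu> s r"
    by (simp add: off_chain_def route_fee_def route_edges_def)
qed

lemma cost_high_fee_single_payment:
  assumes "0 < F_B" "F_B \<le> f0" "u \<in> nodes N"
  shows "cost N F_B f0 (homogeneous_scenario N 1) \<mu> u =
    (real (card (\<mu> u)) + real (card {r \<in> nodes N - {u}. {u, r} \<notin> channels N \<mu>})) * F_B"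
proof -
  define A where "A = {(s, r). s \<in> nodes N \<and> r \<in> nodes N \<and> s \<noteq> r}"
  have "A \<subseteq> nodes N \<times> nodes N" by (auto simp: A_def)
  hence finA: "finite A" by (rule finite_subset) (simp add: nodes_def)
  have T: "homogeneous_scenario N 1 = mset_set A"
    by (simp add: homogeneous_scenario_def A_def)
  have rev: "forwarding_revenue N F_B f0 \<mu> u t = 0" if "t \<in> A" for t
    using that assms direct_route[of "fst t" N "snd t" \<mu>]
    by (auto simp: A_def forwarding_revenue_def off_chain_high_fee_iff intermediaries_def
        pmf_of_set_singleton)
  have snd_fee: "sender_fee N F_B f0 \<mu> (u, r) = (if {u, r} \<in> channels N \<mu> then 0 else F_B)"
    if "r \<in> nodes N - {u}" for r
    using that assms direct_route[of u N r \<mu>]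
    by (auto simp: sender_fee_def off_chain_high_fee_iff route_fee_def route_edges_def
        pmf_of_set_singleton)
  have "(\<Sum>t\<in>#homogeneous_scenario N 1. forwarding_revenue N F_B f0 \<mu> u t) = 0"
    unfolding T using rev by (simp add: sum_unfold_sum_mset[symmetric])
  moreover have "(\<Sum>t\<in>#filter_mset (\<lambda>t. fst t = u) (homogeneous_scenario N 1).
      sender_fee N F_B f0 \<mu> t)
    = real (card {r \<in> nodes N - {u}. {u, r} \<notin> channels N \<mu>}) * F_B"
  proof -
    have *: "{t \<in> A. fst t = u} = Pair u ` (nodes N - {u})"
      using assms by (auto simp: A_def)
    have "(\<Sum>t\<in>#filter_mset (\<lambda>t. fst t = u) (homogeneous_scenario N 1).
      sender_fee N F_B f0 \<mu> t) = (\<Sum>t\<in>Pair u ` (nodes N - {u}). sender_fee N F_B f0 \<mu> t)"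
      unfolding T using finA by (simp add: filter_mset_mset_set * sum_unfold_sum_mset)
    also have "\<dots> = (\<Sum>r\<in>nodes N - {u}. sender_fee N F_B f0 \<mu> (u, r))"
      by (subst sum.reindex) (auto simp: inj_on_def)
    also have "\<dots> = (\<Sum>r\<in>nodes N - {u}. if {u, r} \<notin> channels N \<mu> then F_B else 0)"
      by (intro sum.cong refl) (simp add: snd_fee)
    also have "\<dots> = (\<Sum>r\<in>{r \<in> nodes N - {u}. {u, r} \<notin> channels N \<mu>}. F_B)"
      by (rule sum.inter_filter[symmetric]) (simp add: nodes_def)
    finally show ?thesis by simp
  qed
  ultimately show ?thesis by (simp add: cost_def algebra_simps)
qed

lemma path_nash_high_fee_single_payment:
  assumes "0 < F_B" "F_B \<le> f0"
  shows "nash_equilibrium N F_B f0 (homogeneous_scenario N 1) (path_strategy N)"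
  unfolding nash_equilibrium_def
proof (intro conjI ballI)
  fix u assume u: "u \<in> nodes N"
  show "path_strategy N u \<in> strategies N u"
    using u by (auto simp: path_strategy_def strategies_def nodes_def)
  fix S assume S: "S \<in> strategies N u"
  define I where "I = {v \<in> nodes N - {u}. u \<in> path_strategy N v}"
  have fin: "finite (nodes N - {u})" by (simp add: nodes_def)
  have open_u: "path_strategy N u \<subseteq> nodes N - {u}" "S \<subseteq> nodes N - {u}"
    using u S by (auto simp: path_strategy_def strategies_def nodes_def)
  have set_eq: "{r \<in> nodes N - {u}. {u, r} \<notin> channels N (path_strategy N)}
      = (nodes N - {u}) - (path_strategy N u \<union> I)"
    "{r \<in> nodes N - {u}. {u, r} \<notin> channels N ((path_strategy N)(u := S))}
      = (nodes N - {u}) - (S \<union> I)"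
    using u by (auto simp: channels_sym_iff I_def)
  have sub: "path_strategy N u \<union> I \<subseteq> nodes N - {u}" "S \<union> I \<subseteq> nodes N - {u}"
    using open_u by (auto simp: I_def)
  have fins: "finite S" "finite I" "finite (path_strategy N u)"
    using finite_subset[OF _ fin] sub by auto
  have disj: "path_strategy N u \<inter> I = {}"
    by (auto simp: path_strategy_def I_def split: if_splits)
  have "card (path_strategy N u \<union> I) = card (path_strategy N u) + card I"
    using fins disj by (simp add: card_Un_disjoint)
  moreover have "card (S \<union> I) \<le> card S + card I" by (rule card_Un_le)
  moreover have "card (path_strategy N u \<union> I) \<le> card (nodes N - {u})"
    "card (S \<union> I) \<le> card (nodes N - {u})"
    using sub fin by (auto intro: card_mono)
  ultimately have "card (path_strategy N u) + card ((nodes N - {u}) - (path_strategy N u \<union> I))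
      \<le> card S + card ((nodes N - {u}) - (S \<union> I))"
    using sub fins by (simp add: card_Diff_subset)
  hence "real (card (path_strategy N u)) + real (card ((nodes N - {u}) - (path_strategy N u \<union> I)))
      \<le> real (card S) + real (card ((nodes N - {u}) - (S \<union> I)))"
    by linarith
  thus "cost N F_B f0 (homogeneous_scenario N 1) (path_strategy N) u
      \<le> cost N F_B f0 (homogeneous_scenario N 1) ((path_strategy N)(u := S)) u"
    unfolding cost_high_fee_single_payment[OF assms u] set_eq
    using assms(1) by (intro mult_right_mono) (simp_all)
qed

end

theory Submission
  imports Defs
begin

text \<open>For \<open>f0 = 0\<close> the cost of a node is \<open>F_B\<close> times the number of channels it opens plus
  \<open>k F_B\<close> for every node it cannot reach. On the path everything is reachable, and the one channel
  of a node \<open>u < N\<close> cannot be saved, since without any own channel \<open>u\<close> loses contact with \<open>u + 1\<close>.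

  For \<open>f0 > 0\<close> the end node \<open>1\<close> earns nothing and its payment to \<open>j\<close> costs
  \<open>min ((j - 2) f0) F_B\<close>. If \<open>f0 < F_B\<close> it profits from replacing its channel to \<open>2\<close> by one
  to \<open>3\<close>: the payments to \<open>2\<close> and \<open>3\<close> exchange their fees, those to \<open>4, \<dots>, N\<close> get
  shorter by one edge, and the one to \<open>4\<close> gets strictly cheaper. If \<open>f0 \<ge> F_B\<close> and
  \<open>k \<ge> 2\<close>, an additional channel to \<open>3\<close> saves \<open>k\<close> on-chain payments.\<close>

section \<open>Repeated multisets and existence of shortest routes\<close>

lemma sum_mset_repeat_mset:
  "(\<Sum>x\<in>#repeat_mset k M. f x) = of_nat k * (\<Sum>x\<in>#M. f x)"
  for f :: "'a \<Rightarrow> 'b::comm_semiring_1"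
  by (induction k) (simp_all add: algebra_simps)

lemma filter_mset_repeat_mset:
  "filter_mset P (repeat_mset k M) = repeat_mset k (filter_mset P M)"
  by (induction k) simp_all

lemma finite_routes: "finite (routes N \<mu> s r)"
proof (rule finite_subset)
  show "routes N \<mu> s r \<subseteq> {p. set p \<subseteq> nodes N \<and> distinct p}"
    by (auto simp: routes_def)
  show "finite {p. set p \<subseteq> nodes N \<and> distinct p}"
    by (rule finite_subset_distinct) (simp add: nodes_def)
qed

lemma finite_shortest_routes: "finite (shortest_routes N \<mu> s r)"
  using finite_routes by (rule rev_finite_subset) (auto simp: shortest_routes_def)

lemma shortest_route_exists:
  assumes "q \<in> routes N \<mu> s r"
  obtains p where "p \<in> shortest_routes N \<mu> s r" "route_edges p \<le> route_edges q"
proof -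
  obtain p where "p \<in> routes N \<mu> s r" "\<forall>q. q \<in> routes N \<mu> s r \<longrightarrow> route_edges p \<le> route_edges q"
    using ex_has_least_nat[of "\<lambda>p. p \<in> routes N \<mu> s r" q route_edges] assms by blast
  with that assms show thesis by (auto simp: shortest_routes_def)
qed

section \<open>Bounds on fees and forwarding revenue\<close>

lemma route_fee_mono:
  assumes "0 \<le> f0" "route_edges p \<le> route_edges q"
  shows "route_fee f0 p \<le> route_fee f0 q"
  using assms unfolding route_fee_def by (intro mult_right_mono) auto

text \<open>An expectation inherits a bound valid on every route, so lower bounds never require
  finding the shortest routes.\<close>

lemma sender_fee_ge:
  assumes "\<And>p. p \<in> routes N \<mu> s r \<Longrightarrow> c \<le> route_fee f0 p" "c \<le> F_B"
  shows "c \<le> sender_fee N F_B f0 \<mu> (s, r)"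
proof (cases "off_chain N F_B f0 \<mu> s r")
  case True
  hence ne: "shortest_routes N \<mu> s r \<noteq> {}" by (auto simp: off_chain_def)
  have "c \<le> measure_pmf.expectation (pmf_of_set (shortest_routes N \<mu> s r)) (route_fee f0)"
    using ne finite_shortest_routes assms(1)
    by (intro measure_pmf.integral_ge_const integrable_measure_pmf_finite)
       (auto simp: AE_measure_pmf_iff shortest_routes_def)
  with True show ?thesis by (simp add: sender_fee_def)
qed (use assms in \<open>simp add: sender_fee_def\<close>)

text \<open>Any route \<open>q\<close> is an upper witness, shortest or not: a shortest route has at
  most as many edges, and if even that one costs at least \<open>F_B\<close>, so does
  \<open>q\<close>. Deviations can thus be evaluated by exhibiting one route per receiver.\<close>

lemma sender_fee_le:
  assumes "0 \<le> f0" "q \<in> routes N \<mu> s r"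
  shows "sender_fee N F_B f0 \<mu> (s, r) \<le> min (route_fee f0 q) F_B"
proof (cases "off_chain N F_B f0 \<mu> s r")
  case True
  then obtain p where p: "p \<in> shortest_routes N \<mu> s r" "route_fee f0 p < F_B"
    by (auto simp: off_chain_def)
  \<comment> \<open>\<open>off_chain\<close> provides a single shortest route below
    \<open>F_B\<close>; all shortest routes have equally many edges, so the bound passes to each
    route in the expectation.\<close>
  have le: "route_fee f0 p' \<le> min (route_fee f0 q) F_B" if p': "p' \<in> shortest_routes N \<mu> s r" for p'
  proof -
    have "route_edges p' \<le> route_edges p" "route_edges p' \<le> route_edges q"
      using p' p(1) assms(2) by (auto simp: shortest_routes_def)
    with p(2) route_fee_mono[OF assms(1)] show ?thesis
      by (metis less_eq_real_def min.bounded_iff order_trans)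
  qed
  have "shortest_routes N \<mu> s r \<noteq> {}" using p(1) by blast
  hence "measure_pmf.expectation (pmf_of_set (shortest_routes N \<mu> s r)) (route_fee f0)
      \<le> min (route_fee f0 q) F_B"
    using finite_shortest_routes le
    by (intro measure_pmf.integral_le_const integrable_measure_pmf_finite)
       (auto simp: AE_measure_pmf_iff set_pmf_of_set)
  with True show ?thesis by (simp add: sender_fee_def)
next
  case False
  obtain p where p: "p \<in> shortest_routes N \<mu> s r" "route_edges p \<le> route_edges q"
    using shortest_route_exists[OF assms(2)] .
  with False have "F_B \<le> route_fee f0 p" by (auto simp: off_chain_def not_less)
  with False route_fee_mono[OF assms(1) p(2)] show ?thesis by (simp add: sender_fee_def)
qed

lemma sender_fee_le_F_B:
  assumes "0 \<le> f0"
  shows "sender_fee N F_B f0 \<mu> (s, r) \<le> F_B"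
proof (cases "routes N \<mu> s r = {}")
  case True
  thus ?thesis by (simp add: sender_fee_def off_chain_def shortest_routes_def)
next
  case False
  then obtain q where "q \<in> routes N \<mu> s r" by blast
  from sender_fee_le[OF assms this, of F_B] show ?thesis by simp
qed

lemma sender_fee_unreachable:
  assumes "routes N \<mu> s r = {}"
  shows "sender_fee N F_B f0 \<mu> (s, r) = F_B"
  using assms by (simp add: sender_fee_def off_chain_def shortest_routes_def)

text \<open>Distinct endpoints force at least one edge; the one-node route would have fee
  \<open>- f0\<close>.\<close>

lemma sender_fee_nonneg:
  assumes "0 \<le> f0" "0 \<le> F_B" "s \<noteq> r"
  shows "0 \<le> sender_fee N F_B f0 \<mu> (s, r)"
proof (rule sender_fee_ge)
  fix p assume "p \<in> routes N \<mu> s r"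
  from routes_length_ge_2[OF this assms(3)] assms(1) show "0 \<le> route_fee f0 p"
    by (simp add: route_fee_def route_edges_def)
qed (use assms in simp)

lemma forwarding_revenue_nonneg:
  assumes "0 \<le> f0"
  shows "0 \<le> forwarding_revenue N F_B f0 \<mu> u t"
  using assms by (auto simp: forwarding_revenue_def split: prod.split intro!: integral_nonneg_AE)

lemma forwarding_revenue_eq_0:
  assumes "f0 = 0 \<or> (\<forall>p \<in> routes N \<mu> (fst t) (snd t). u \<notin> intermediaries p)"
  shows "forwarding_revenue N F_B f0 \<mu> u t = 0"
proof (cases t)
  case (Pair s r)
  have "measure_pmf.expectation (pmf_of_set (shortest_routes N \<mu> s r))
      (\<lambda>p. if u \<in> intermediaries p then f0 else 0) = 0" if "off_chain N F_B f0 \<mu> s r"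
  proof -
    have ne: "shortest_routes N \<mu> s r \<noteq> {}" using that by (auto simp: off_chain_def)
    have "AE p in measure_pmf (pmf_of_set (shortest_routes N \<mu> s r)).
        (if u \<in> intermediaries p then f0 else 0) = 0"
      using assms ne finite_shortest_routes Pair
      by (auto simp: AE_measure_pmf_iff shortest_routes_def)
    thus ?thesis by (rule integral_eq_zero_AE)
  qed
  with Pair show ?thesis by (simp add: forwarding_revenue_def)
qed

section \<open>Cost in the homogeneous scenario\<close>

definition ordered_pairs :: "nat \<Rightarrow> transaction set" where
  "ordered_pairs N = {(s, r). s \<in> nodes N \<and> r \<in> nodes N \<and> s \<noteq> r}"

lemma finite_nodes: "finite (nodes N)"
  by (simp add: nodes_def)

lemma finite_ordered_pairs: "finite (ordered_pairs N)"
  by (rule finite_subset[of _ "nodes N \<times> nodes N"]) (auto simp: ordered_pairs_def finite_nodes)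

lemma cost_homogeneous:
  assumes "u \<in> nodes N"
  shows "cost N F_B f0 (homogeneous_scenario N k) \<mu> u =
    real (card (\<mu> u)) * F_B + real k * (\<Sum>r\<in>nodes N - {u}. sender_fee N F_B f0 \<mu> (u, r))
    - real k * (\<Sum>t\<in>ordered_pairs N. forwarding_revenue N F_B f0 \<mu> u t)"
proof -
  have T: "homogeneous_scenario N k = repeat_mset k (mset_set (ordered_pairs N))"
    by (simp add: homogeneous_scenario_def ordered_pairs_def)
  have "{t \<in> ordered_pairs N. fst t = u} = Pair u ` (nodes N - {u})"
    using assms by (auto simp: ordered_pairs_def)
  hence "(\<Sum>t\<in>#filter_mset (\<lambda>t. fst t = u) (mset_set (ordered_pairs N)). sender_fee N F_B f0 \<mu> t)
      = (\<Sum>t\<in>Pair u ` (nodes N - {u}). sender_fee N F_B f0 \<mu> t)"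
    using finite_ordered_pairs by (simp add: filter_mset_mset_set sum_unfold_sum_mset)
  also have "\<dots> = (\<Sum>r\<in>nodes N - {u}. sender_fee N F_B f0 \<mu> (u, r))"
    by (subst sum.reindex) (auto simp: inj_on_def)
  finally show ?thesis
    unfolding cost_def T filter_mset_repeat_mset sum_mset_repeat_mset
    by (simp add: sum_unfold_sum_mset)
qed

text \<open>Revenue only lowers the cost, so an upper bound may drop it.\<close>

lemma cost_homogeneous_le:
  assumes "u \<in> nodes N" "0 \<le> f0"
    and "\<And>r. r \<in> nodes N - {u} \<Longrightarrow> sender_fee N F_B f0 \<mu> (u, r) \<le> g r"
  shows "cost N F_B f0 (homogeneous_scenario N k) \<mu> u
    \<le> real (card (\<mu> u)) * F_B + real k * (\<Sum>r\<in>nodes N - {u}. g r)"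
proof -
  have "real k * (\<Sum>r\<in>nodes N - {u}. sender_fee N F_B f0 \<mu> (u, r))
      \<le> real k * (\<Sum>r\<in>nodes N - {u}. g r)"
    using assms(3) by (intro mult_left_mono sum_mono) auto
  moreover have "0 \<le> real k * (\<Sum>t\<in>ordered_pairs N. forwarding_revenue N F_B f0 \<mu> u t)"
    using assms(2) by (intro mult_nonneg_nonneg sum_nonneg forwarding_revenue_nonneg) auto
  ultimately show ?thesis unfolding cost_homogeneous[OF assms(1)] by linarith
qed

text \<open>A lower bound may ignore revenue only where it vanishes. The two alternatives serve the
  case without fee and the end node of the path.\<close>

lemma cost_homogeneous_ge:
  assumes "u \<in> nodes N"
    and "f0 = 0 \<or> (\<forall>s r. \<forall>p \<in> routes N \<mu> s r. u \<notin> intermediaries p)"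
    and "\<And>r. r \<in> nodes N - {u} \<Longrightarrow> g r \<le> sender_fee N F_B f0 \<mu> (u, r)"
  shows "real (card (\<mu> u)) * F_B + real k * (\<Sum>r\<in>nodes N - {u}. g r)
    \<le> cost N F_B f0 (homogeneous_scenario N k) \<mu> u"
proof -
  have "real k * (\<Sum>r\<in>nodes N - {u}. g r)
      \<le> real k * (\<Sum>r\<in>nodes N - {u}. sender_fee N F_B f0 \<mu> (u, r))"
    using assms(3) by (intro mult_left_mono sum_mono) auto
  moreover have "(\<Sum>t\<in>ordered_pairs N. forwarding_revenue N F_B f0 \<mu> u t) = 0"
    using assms(2) by (intro sum.neutral ballI forwarding_revenue_eq_0) auto
  ultimately show ?thesis unfolding cost_homogeneous[OF assms(1)] by simp
qed

section \<open>Routes in the path graph\<close>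

lemma route_nth_channel:
  assumes "p \<in> routes N \<mu> s r" "Suc i < length p"
  shows "{p ! i, p ! Suc i} \<in> channels N \<mu>"
  using assms by (auto simp: routes_def successively_conv_nth)

lemma path_channel_iff:
  "{a, b} \<in> channels N (path_strategy N)
    \<longleftrightarrow> a \<in> nodes N \<and> b \<in> nodes N \<and> (b = Suc a \<or> a = Suc b)"
proof (cases "a \<in> nodes N \<and> b \<in> nodes N")
  case True
  thus ?thesis by (auto simp: channels_sym_iff path_strategy_def nodes_def)
next
  case False
  have "x \<in> nodes N \<and> y \<in> nodes N" if "x \<in> nodes N" "y \<in> path_strategy N x" for x y
    using that by (simp add: path_strategy_def nodes_def split: if_splits)
  with False show ?thesis unfolding channels_def doubleton_eq_iff mem_Collect_eq by metis
qed

lemma path_route_up: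
  assumes "1 \<le> s" "s \<le> r" "r \<le> N"
  shows "[s..<Suc r] \<in> routes N (path_strategy N) s r"
  using assms
  by (auto simp: routes_def nodes_def successively_conv_nth path_channel_iff simp del: upt_Suc)

lemma routes_rev:
  assumes "p \<in> routes N \<mu> s r"
  shows "rev p \<in> routes N \<mu> r s"
  using assms by (auto simp: routes_def hd_rev last_rev insert_commute)

lemma path_connected:
  assumes "s \<in> nodes N" "r \<in> nodes N"
  shows "routes N (path_strategy N) s r \<noteq> {}"
proof (cases "s \<le> r")
  case True
  with path_route_up[of s r N] assms show ?thesis by (auto simp: nodes_def)
next
  case False
  with routes_rev[OF path_route_up[of r s N]] assms show ?thesis by (auto simp: nodes_def)
qed

text \<open>Each edge of the path graph raises the node number by at most one.\<close>

lemma path_route_edges_ge: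
  assumes "p \<in> routes N (path_strategy N) s r"
  shows "r \<le> s + route_edges p"
proof -
  have "p ! i \<le> s + i" if "i < length p" for i
    using that
  proof (induction i)
    case 0
    thus ?case using assms by (auto simp: routes_def hd_conv_nth)
  next
    case (Suc i)
    with route_nth_channel[OF assms, of i] show ?case by (auto simp: path_channel_iff)
  qed
  from this[of "length p - 1"] assms show ?thesis
    by (auto simp: routes_def route_edges_def last_conv_nth)
qed

text \<open>A route passing through node \<open>1\<close> would visit its only neighbour \<open>2\<close> twice.\<close>

lemma path_end_not_intermediary:
  assumes "p \<in> routes N (path_strategy N) s r"
  shows "1 \<notin> intermediaries p"
proof
  assume "1 \<in> intermediaries p"
  then obtain i where i: "Suc (Suc i) < length p" "p ! Suc i = 1"
    by (auto simp: intermediaries_def in_set_conv_nth nth_butlast nth_tl less_diff_conv)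
  have "p ! i = 2" "p ! Suc (Suc i) = 2"
    using route_nth_channel[OF assms, of i] route_nth_channel[OF assms, of "Suc i"] i
    by (auto simp: path_channel_iff nodes_def)
  moreover have "distinct p" using assms by (simp add: routes_def)
  ultimately show False using i nth_eq_iff_index_eq[of p i "Suc (Suc i)"] by simp
qed

text \<open>The only channel joining \<open>{..u}\<close> to larger nodes is the one
  \<open>u\<close> opened, so a route starting at \<open>u\<close> never leaves
  \<open>{..u}\<close>.\<close>

lemma path_unreachable_without_channel:
  "routes N ((path_strategy N)(u := {})) u (Suc u) = {}"
proof (rule equals0I)
  fix p assume p: "p \<in> routes N ((path_strategy N)(u := {})) u (Suc u)"
  have "p ! i \<le> u" if "i < length p" for i
    using that
  proof (induction i)
    case 0
    thus ?case using p by (auto simp: routes_def hd_conv_nth)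
  next
    case (Suc i)
    with route_nth_channel[OF p, of i] show ?case
      by (auto simp: channels_def path_strategy_def doubleton_eq_iff split: if_splits)
  qed
  from this[of "length p - 1"] p show False by (auto simp: routes_def last_conv_nth)
qed

section \<open>No forwarding fee: the path is an equilibrium\<close>

lemma path_nash_no_fee:
  assumes "F_B > 0" "k \<ge> 1"
  shows "nash_equilibrium N F_B 0 (homogeneous_scenario N k) (path_strategy N)"
  unfolding nash_equilibrium_def
proof (intro conjI ballI)
  fix u assume u: "u \<in> nodes N"
  show "path_strategy N u \<in> strategies N u"
    using u by (auto simp: path_strategy_def strategies_def nodes_def)
  fix S assume S: "S \<in> strategies N u"
  let ?\<mu>' = "(path_strategy N)(u := S)"
  have "sender_fee N F_B 0 (path_strategy N) (u, r) \<le> 0" if r: "r \<in> nodes N - {u}" for r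
  proof -
    obtain p where "p \<in> routes N (path_strategy N) u r" using path_connected[OF u, of r] r by blast
    from sender_fee_le[OF _ this, of 0 F_B] assms show ?thesis by (simp add: route_fee_def)
  qed
  with cost_homogeneous_le[OF u, of 0 F_B "path_strategy N" "\<lambda>_. 0" k]
  have path: "cost N F_B 0 (homogeneous_scenario N k) (path_strategy N) u
      \<le> real (card (path_strategy N u)) * F_B" by simp
  \<comment> \<open>With \<open>g\<close> chosen as the sender fee itself, this only discards the
    revenue, which is zero for zero fee.\<close>
  have dev: "real (card S) * F_B + real k * (\<Sum>r\<in>nodes N - {u}. sender_fee N F_B 0 ?\<mu>' (u, r))
      \<le> cost N F_B 0 (homogeneous_scenario N k) ?\<mu>' u"
    using cost_homogeneous_ge[OF u, of 0 ?\<mu>' "\<lambda>r. sender_fee N F_B 0 ?\<mu>' (u, r)" F_B k] by simp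
  have nonneg: "0 \<le> sender_fee N F_B 0 ?\<mu>' (u, r)" if "r \<in> nodes N - {u}" for r
    using that assms by (intro sender_fee_nonneg) auto
  have "real (card (path_strategy N u)) * F_B
      \<le> real (card S) * F_B + real k * (\<Sum>r\<in>nodes N - {u}. sender_fee N F_B 0 ?\<mu>' (u, r))"
  \<comment> \<open>Only here does the deviation open fewer channels than the path; losing receiver
    \<open>Suc u\<close> then costs \<open>k * F_B\<close>, at least the \<open>F_B\<close>
    saved.\<close>
  proof (cases "S = {} \<and> u < N")
    case True
    have "F_B = sender_fee N F_B 0 ?\<mu>' (u, Suc u)"
      using sender_fee_unreachable[OF path_unreachable_without_channel] True by simp
    also have "\<dots> \<le> (\<Sum>r\<in>nodes N - {u}. sender_fee N F_B 0 ?\<mu>' (u, r))"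
      using True nonneg by (intro member_le_sum) (auto simp: nodes_def)
    finally have "1 * F_B \<le> real k * (\<Sum>r\<in>nodes N - {u}. sender_fee N F_B 0 ?\<mu>' (u, r))"
      using assms by (intro mult_mono) auto
    with True u show ?thesis by (simp add: path_strategy_def nodes_def)
  next
    case False
    have "finite S"
      using S finite_nodes by (auto simp: strategies_def intro: finite_subset)
    with False have "card (path_strategy N u) \<le> card S"
      by (auto simp: path_strategy_def Suc_le_eq card_gt_0_iff)
    hence "real (card (path_strategy N u)) * F_B \<le> real (card S) * F_B"
      using assms by (intro mult_right_mono) auto
    moreover have "0 \<le> real k * (\<Sum>r\<in>nodes N - {u}. sender_fee N F_B 0 ?\<mu>' (u, r))"
      using nonneg by (intro mult_nonneg_nonneg sum_nonneg) auto
    ultimately show ?thesis by linarith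
  qed
  with path dev show "cost N F_B 0 (homogeneous_scenario N k) (path_strategy N) u
      \<le> cost N F_B 0 (homogeneous_scenario N k) ?\<mu>' u" by linarith
qed

section \<open>Positive forwarding fee: profitable deviations of node 1\<close>

lemma nodes_eq_insert_1_2_3:
  assumes "N \<ge> 3"
  shows "nodes N - {1} = insert 2 (insert 3 {4..N})"
  using assms by (auto simp: nodes_def)

text \<open>Receiver \<open>r\<close> is at least \<open>r - 1\<close> edges away, hence the fee
  bound \<open>(r - 2) * f0\<close>. Receiver 2 contributes zero and receiver 3 is split off,
  leaving a sum over \<open>4..N\<close> to compare termwise with the deviations.\<close>

lemma cost_path_end_ge:
  assumes "N \<ge> 3" "F_B > 0" "f0 \<ge> 0"
  shows "F_B + real k * (min f0 F_B + (\<Sum>r = 4..N. min ((real r - 2) * f0) F_B))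
    \<le> cost N F_B f0 (homogeneous_scenario N k) (path_strategy N) 1"
proof -
  have fee: "min ((real r - 2) * f0) F_B \<le> sender_fee N F_B f0 (path_strategy N) (1, r)" for r
  proof (rule sender_fee_ge)
    fix p assume "p \<in> routes N (path_strategy N) 1 r"
    from path_route_edges_ge[OF this] have "(real r - 2) * f0 \<le> route_fee f0 p"
      unfolding route_fee_def using assms by (intro mult_right_mono) auto
    thus "min ((real r - 2) * f0) F_B \<le> route_fee f0 p" by simp
  qed simp
  have "real (card (path_strategy N 1)) * F_B
      + real k * (\<Sum>r\<in>nodes N - {1}. min ((real r - 2) * f0) F_B)
      \<le> cost N F_B f0 (homogeneous_scenario N k) (path_strategy N) 1"
    using assms fee path_end_not_intermediary
    by (intro cost_homogeneous_ge) (auto simp: nodes_def)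
  moreover have "card (path_strategy N 1) = 1" using assms by (simp add: path_strategy_def)
  ultimately show ?thesis
    unfolding nodes_eq_insert_1_2_3[OF assms(1)] using assms by simp
qed

lemma shortcut_route:
  assumes "3 \<le> r" "r \<le> N"
  shows "1 # [3..<Suc r] \<in> routes N ((path_strategy N)(1 := {3})) 1 r"
proof -
  have "{3 + i, 4 + i} \<in> channels N ((path_strategy N)(1 := {3}))" if "3 + i < N" for i
    using that by (simp add: channels_sym_iff nodes_def path_strategy_def)
  hence "successively (\<lambda>u v. {u, v} \<in> channels N ((path_strategy N)(1 := {3}))) [3..<Suc r]"
    using assms by (simp add: successively_conv_nth del: upt_Suc)
  moreover have "{1, 3} \<in> channels N ((path_strategy N)(1 := {3}))"
    using assms by (simp add: channels_sym_iff nodes_def)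
  ultimately show ?thesis
    using assms by (auto simp: routes_def nodes_def successively_Cons simp del: upt_Suc)
qed

text \<open>Node 2 still holds its own channel to 3, which is now crossed backwards.\<close>

lemma shortcut_route_to_2:
  assumes "3 \<le> N"
  shows "[1, 3, 2] \<in> routes N ((path_strategy N)(1 := {3})) 1 2"
  using assms by (auto simp: routes_def nodes_def channels_sym_iff path_strategy_def)

lemma path_not_nash_low_fee:
  assumes "N > 3" "k \<ge> 1" "0 < f0" "f0 < F_B"
  shows "\<not> nash_equilibrium N F_B f0 (homogeneous_scenario N k) (path_strategy N)"
proof
  let ?\<mu>' = "(path_strategy N)(1 := {3})"
  let ?c = "cost N F_B f0 (homogeneous_scenario N k)"
  \<comment> \<open>These are the fees of the two shortcut routes, capped by \<open>F_B\<close> from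
    receiver 3 on. Receiver 2 is separate because it is reached by the detour through 3.\<close>
  define g where "g r = (if r = 2 then f0 else min ((real r - 3) * f0) F_B)" for r :: nat
  assume "nash_equilibrium N F_B f0 (homogeneous_scenario N k) (path_strategy N)"
  hence "?c (path_strategy N) 1 \<le> ?c ?\<mu>' 1"
    using assms by (auto simp: nash_equilibrium_def strategies_def nodes_def)
  also have "\<dots> \<le> real (card (?\<mu>' 1)) * F_B + real k * (\<Sum>r\<in>nodes N - {1}. g r)"
  proof (rule cost_homogeneous_le)
    fix r assume r: "r \<in> nodes N - {1}"
    show "sender_fee N F_B f0 ?\<mu>' (1, r) \<le> g r"
    proof (cases "r = 2")
      case True
      with sender_fee_le[OF _ shortcut_route_to_2[of N], of f0 F_B] assms show ?thesis
        by (simp add: g_def route_fee_def route_edges_def)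
    next
      case False
      with r have r': "3 \<le> r" "r \<le> N" by (auto simp: nodes_def)
      hence "real (route_edges (1 # [3..<Suc r])) - 1 = real r - 3"
        by (simp add: route_edges_def of_nat_diff del: upt_Suc)
      hence "route_fee f0 (1 # [3..<Suc r]) = (real r - 3) * f0"
        by (simp only: route_fee_def)
      with sender_fee_le[OF _ shortcut_route[OF r'], of f0 F_B] assms False show ?thesis
        by (simp add: g_def del: upt_Suc)
    qed
  qed (use assms in \<open>auto simp: nodes_def\<close>)
  also have "\<dots> = F_B + real k * (f0 + (\<Sum>r = 4..N. min ((real r - 3) * f0) F_B))"
  proof -
    have "(\<Sum>r\<in>nodes N - {1}. g r) = f0 + (\<Sum>r = 4..N. g r)"
      unfolding nodes_eq_insert_1_2_3[OF less_imp_le[OF assms(1)]] using assms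
      by (simp add: g_def)
    also have "(\<Sum>r = 4..N. g r) = (\<Sum>r = 4..N. min ((real r - 3) * f0) F_B)"
      by (intro sum.cong) (auto simp: g_def)
    finally show ?thesis by simp
  qed
  also have "\<dots> < F_B + real k * (min f0 F_B + (\<Sum>r = 4..N. min ((real r - 2) * f0) F_B))"
  proof -
    have "(\<Sum>r = 4..N. min ((real r - 3) * f0) F_B) < (\<Sum>r = 4..N. min ((real r - 2) * f0) F_B)"
    proof (rule sum_strict_mono_ex1)
      show "\<forall>r\<in>{4..N}. min ((real r - 3) * f0) F_B \<le> min ((real r - 2) * f0) F_B"
        using assms by (intro ballI min.mono mult_right_mono) auto
      \<comment> \<open>At receiver 4 the terms are \<open>f0\<close> and
        \<open>min (2 * f0) F_B\<close>, which differ because \<open>0 < f0 < F_B\<close>;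
        \<open>N > 3\<close> ensures that this receiver exists.\<close>
      show "\<exists>r\<in>{4..N}. min ((real r - 3) * f0) F_B < min ((real r - 2) * f0) F_B"
        using assms by (intro bexI[of _ 4]) auto
    qed simp
    thus ?thesis using assms by simp
  qed
  also have "\<dots> \<le> ?c (path_strategy N) 1"
    using assms by (intro cost_path_end_ge) auto
  finally show False by simp
qed

lemma path_not_nash_high_fee:
  assumes "N \<ge> 3" "k \<ge> 2" "F_B > 0" "F_B \<le> f0"
  shows "\<not> nash_equilibrium N F_B f0 (homogeneous_scenario N k) (path_strategy N)"
proof
  let ?\<mu>' = "(path_strategy N)(1 := {2, 3})"
  let ?c = "cost N F_B f0 (homogeneous_scenario N k)"
  \<comment> \<open>Receivers 2 and 3 have direct channels; for the others the universal bound
    \<open>F_B\<close> suffices, since on the path they already cost that much.\<close>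
  define g where "g r = (if r \<in> {2, 3} then 0 else F_B)" for r :: nat
  assume "nash_equilibrium N F_B f0 (homogeneous_scenario N k) (path_strategy N)"
  hence "?c (path_strategy N) 1 \<le> ?c ?\<mu>' 1"
    using assms by (auto simp: nash_equilibrium_def strategies_def nodes_def)
  also have "\<dots> \<le> real (card (?\<mu>' 1)) * F_B + real k * (\<Sum>r\<in>nodes N - {1}. g r)"
  proof (rule cost_homogeneous_le)
    fix r assume r: "r \<in> nodes N - {1}"
    show "sender_fee N F_B f0 ?\<mu>' (1, r) \<le> g r"
    proof (cases "r \<in> {2, 3}")
      case True
      hence "[1, r] \<in> routes N ?\<mu>' 1 r"
        using assms by (auto simp: routes_def nodes_def channels_sym_iff)
      from sender_fee_le[OF _ this, of f0 F_B] assms True show ?thesis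
        by (auto simp: g_def route_fee_def route_edges_def)
    next
      case False
      with sender_fee_le_F_B[of f0] assms show ?thesis by (simp add: g_def)
    qed
  qed (use assms in \<open>auto simp: nodes_def\<close>)
  also have "\<dots> = 2 * F_B + real k * (\<Sum>r = 4..N. F_B)"
  proof -
    have "(\<Sum>r\<in>nodes N - {1}. g r) = (\<Sum>r = 4..N. g r)"
      unfolding nodes_eq_insert_1_2_3[OF assms(1)] by (simp add: g_def)
    also have "\<dots> = (\<Sum>r = 4..N. F_B)"
      by (intro sum.cong) (auto simp: g_def)
    finally show ?thesis by simp
  qed
  also have "\<dots> < F_B + real k * (F_B + (\<Sum>r = 4..N. F_B))"
  proof -
    \<comment> \<open>The extra channel costs \<open>F_B\<close> and saves \<open>k\<close> on-chain
      payments to node 3; \<open>k \<ge> 2\<close> makes the gain strict.\<close>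
    have "1 * F_B < real k * F_B" using assms by (intro mult_strict_right_mono) auto
    thus ?thesis by (simp add: algebra_simps)
  qed
  also have "\<dots> = F_B + real k * (min f0 F_B + (\<Sum>r = 4..N. min ((real r - 2) * f0) F_B))"
  proof -
    have "F_B \<le> (real r - 2) * f0" if "r \<in> {4..N}" for r
    proof -
      have "1 * F_B \<le> (real r - 2) * f0" using that assms by (intro mult_mono) auto
      thus ?thesis by simp
    qed
    hence "(\<Sum>r = 4..N. min ((real r - 2) * f0) F_B) = (\<Sum>r = 4..N. F_B)"
      by (intro sum.cong) auto
    with assms show ?thesis by simp
  qed
  also have "\<dots> \<le> ?c (path_strategy N) 1"
    using assms by (intro cost_path_end_ge) auto
  finally show False by simp
qed

text \<open>The exception in the second claim is genuine: for \<open>k = 1\<close> and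
  \<open>F_B \<le> f0\<close> the path is an equilibrium by
  \<open>path_nash_high_fee_single_payment\<close>.\<close>

theorem mainTheorem1:
  fixes N k :: nat and F_B f0 :: real
  assumes "N > 3" and "k \<ge> 1" and "F_B > 0" and "f0 \<ge> 0"
  shows "(f0 = 0 \<longrightarrow>
            nash_equilibrium N F_B f0 (homogeneous_scenario N k) (path_strategy N)) \<and>
         (f0 > 0 \<and> \<not> (k = 1 \<and> f0 \<ge> F_B) \<longrightarrow>
            \<not> nash_equilibrium N F_B f0 (homogeneous_scenario N k) (path_strategy N))"
proof (intro conjI impI)
  assume "f0 = 0"
  with path_nash_no_fee assms
  show "nash_equilibrium N F_B f0 (homogeneous_scenario N k) (path_strategy N)" by simp
next
  assume f0: "f0 > 0 \<and> \<not> (k = 1 \<and> f0 \<ge> F_B)"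
  show "\<not> nash_equilibrium N F_B f0 (homogeneous_scenario N k) (path_strategy N)"
  proof (cases "f0 < F_B")
    case True
    with f0 path_not_nash_low_fee assms show ?thesis by blast
  next
    case False
    with f0 assms show ?thesis by (intro path_not_nash_high_fee) auto
  qed
qed

end
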